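(* Let $n,m,l\in\mathbb{N}$ with $1\le m\le n-1$ and $m+1\le l\le n-1$, and let $(M_{m,n-l}(t),N_{m,l-m}(t))$ be a Luchko pair of kernels from the subset $T_{n,m,l}\subset L_n$. Then, for the general fractional derivative $D^*_{(N)}$ of Caputo type and the general fractional integral $I_{(M)}$ associated with this pair, the equality $$D^*_{(N)} I_{(M)} X(t) = X(t)$$ holds (for $t>0$) for every $X(t)\in C_{-1,(N)}(0,\infty)$, where $$C_{-1,(N)}(0,\infty) := \{X:\ X(t) = I_{(N)}Y(t) = (N_{m,l-m} * Y)(t),\ Y(t)\in C_{-1}(0,\infty)\}.$$
   Context: $C_{-1}(0,\infty)$ is the space of functions $f$ on $(0,\infty)$ that can be represented as $f(t)=t^p g(t)$ for $t>0$ with some $p>-1$ and $g\in C[0,\infty)$. $C_{-1,0}(0,\infty)$ is the space of functions $f$ on $(0,\infty)$ that can be represented as $f(t)=t^p g(t)$ for $t>0$ with some $-1<p<0$ and $g\in C[0,\infty)$. $C^n_{-1}(0,\infty):=\{X:\ X^{(n)}(t)\in C_{-1}(0,\infty)\}$. The symbol $*$ denotes the Laplace convolution $(f*g)(t)=\int_0^t f(t-\tau)g(\tau)\,d\tau$, $t>0$. $\{1\}$ is the function identically equal to $1$, and for $n\in\mathbb{N}$, $\{1\}^n$ is its $n$-fold convolution power, $\{1\}^n=h_n(t)=\frac{t^{n-1}}{(n-1)!}$. For $n\in\mathbb{N}$, the Luchko set $L_n$ is the set of pairs $(M(t),N(t))$ (Luchko pairs) with $M,N\in C_{-1}(0,\infty)$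 such that $(M*N)(t)=\{1\}^n$ for all $t\in(0,\infty)$. A Sonine pair is a pair $(\mu(t),\nu(t))$ with $\mu,\nu\in C_{-1,0}(0,\infty)$ and $(\mu*\nu)(t)=\{1\}$ for all $t\in(0,\infty)$; Sonine pairs belong to $L_1$. $T_m$ is the subset of $L_m$ consisting of the pairs in $L_m$ of the form $(\mu_1*\ldots*\mu_m,\ \nu_1*\ldots*\nu_m)$, where $(\mu_k,\nu_k)$ are Sonine pairs from $L_1$ for all $k=1,\dots,m$. $T_{n,m,l}$ is the subset of $L_n$ consisting of the pairs in $L_n$ of the form $$M_{m,n-l}(t)=(\{1\}^{n-l}*M_m)(t),\quad N_{m,l-m}(t)=(\{1\}^{l-m}*N_m)(t)$$ with $(M_m(t),N_m(t))\in T_m$. For $(M_{m,n-l},N_{m,l-m})\in T_{n,m,l}$: the general fractional integral is $I_{(M)}X(t)=(M_{m,n-l}*X)(t)=\int_0^t M_{m,n-l}(t-\tau)X(\tau)\,d\tau$ for $X\in C_{-1}(0,\infty)$ (and likewise $I_{(N)}Y(t)=(N_{m,l-m}*Y)(t)$); the general fractional derivative of Caputo type is $D^*_{(N)}X(t)=(N_{m,l-m}*X^{(n)})(t)=\int_0^t N_{m,l-m}(t-\tau)X^{(n)}(\tau)\,d\tau$ for $X\in C^n_{-1}(0,\infty)$. *)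

theory Defs
  imports "HOL-Analysis.Analysis"
begin

text \<open>
  Functions on the open half-line are rendered as total functions on the reals. Only their values
  at positive arguments matter, so every equality of such functions is asserted for positive
  arguments only, and convolutions integrate over an open interval.
\<close>

definition C_m1 :: "(real \<Rightarrow> real) set" where
  "C_m1 = {f. \<exists>p g. p > -1 \<and> continuous_on {0..} g \<and> (\<forall>t>0. f t = t powr p * g t)}"

definition C_m1_0 :: "(real \<Rightarrow> real) set" where
  "C_m1_0 = {f. \<exists>p g. -1 < p \<and> p < 0 \<and> continuous_on {0..} g \<and> (\<forall>t>0. f t = t powr p * g t)}"

text \<open>Existence of the derivatives up to order \<open>n\<close> has to be required explicitly, because
  \<^const>\<open>deriv\<close> is a total operator.\<close>

definition C_m1_diff :: "nat \<Rightarrow> (real \<Rightarrow> real) set" where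
  "C_m1_diff n = {X. (\<forall>k<n. \<forall>t>0. (deriv ^^ k) X differentiable at t) \<and> (deriv ^^ n) X \<in> C_m1}"

definition conv :: "(real \<Rightarrow> real) \<Rightarrow> (real \<Rightarrow> real) \<Rightarrow> real \<Rightarrow> real" where
  "conv f g t = (LINT \<tau>:{0<..<t}|lborel. f (t - \<tau>) * g \<tau>)"

text \<open>\<open>conv_prod f m\<close> is the convolution product of \<open>f 1\<close>, ..., \<open>f m\<close>. There is no neutral
  function for convolution, so the value at \<open>m = 0\<close> is a dummy.\<close>

fun conv_prod :: "(nat \<Rightarrow> real \<Rightarrow> real) \<Rightarrow> nat \<Rightarrow> real \<Rightarrow> real" where
  "conv_prod f 0 = (\<lambda>t. 0)"
| "conv_prod f (Suc 0) = f 1"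
| "conv_prod f (Suc (Suc k)) = conv (conv_prod f (Suc k)) (f (Suc (Suc k)))"

definition one_pow :: "nat \<Rightarrow> real \<Rightarrow> real" where
  "one_pow n = conv_prod (\<lambda>_ _. 1) n"

lemma one_pow_eq:
  assumes "n \<ge> 1" "t > 0"
  shows "one_pow n t = t ^ (n - 1) / fact (n - 1)"
proof -
  have "one_pow (Suc k) t = t ^ k / fact k" for k
    using \<open>t > 0\<close>
  proof (induction k arbitrary: t)
    case 0
    then show ?case by (simp add: one_pow_def)
  next
    case (Suc k)
    let ?F = "\<lambda>\<tau>. - ((t - \<tau>) ^ Suc k / fact (Suc k))"
    have "one_pow (Suc (Suc k)) t = (LINT \<tau>:{0<..<t}|lborel. one_pow (Suc k) (t - \<tau>))"
      by (simp add: one_pow_def conv_def)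
    also have "\<dots> = (LINT \<tau>:{0<..<t}|lborel. (t - \<tau>) ^ k / fact k)"
      by (rule set_lebesgue_integral_cong) (use Suc.IH in auto)
    also have "\<dots> = (LBINT \<tau>=0..t. (t - \<tau>) ^ k / fact k)"
      using Suc.prems by (simp add: interval_lebesgue_integral_def zero_ereal_def)
    also have "\<dots> = ?F t - ?F 0"
    proof (rule interval_integral_FTC_finite[where a = 0, folded zero_ereal_def])
      fix x :: real
      have "(?F has_real_derivative (t - x) ^ k / fact k) (at x within {min 0 t..max 0 t})"
        by (auto intro!: derivative_eq_intros simp: divide_simps simp del: power_Suc of_nat_Suc)
      then show "(?F has_vector_derivative (t - x) ^ k / fact k) (at x within {min 0 t..max 0 t})"
        by (simp add: has_real_derivative_iff_has_vector_derivative)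
    qed (auto intro!: continuous_intros)
    finally show ?case by simp
  qed
  from this[of "n - 1"] show ?thesis using \<open>n \<ge> 1\<close> by simp
qed

definition Luchko :: "nat \<Rightarrow> ((real \<Rightarrow> real) \<times> (real \<Rightarrow> real)) set" where
  "Luchko n = {(M, N). M \<in> C_m1 \<and> N \<in> C_m1 \<and> (\<forall>t>0. conv M N t = one_pow n t)}"

definition Sonine :: "((real \<Rightarrow> real) \<times> (real \<Rightarrow> real)) set" where
  "Sonine = {(\<mu>, \<nu>). \<mu> \<in> C_m1_0 \<and> \<nu> \<in> C_m1_0 \<and> (\<forall>t>0. conv \<mu> \<nu> t = 1)}"

definition T_set :: "nat \<Rightarrow> ((real \<Rightarrow> real) \<times> (real \<Rightarrow> real)) set" where
  "T_set m = {(M, N). (M, N) \<in> Luchko m \<and>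
     (\<exists>\<mu> \<nu>. (\<forall>k\<in>{1..m}. (\<mu> k, \<nu> k) \<in> Sonine) \<and>
            (\<forall>t>0. M t = conv_prod \<mu> m t \<and> N t = conv_prod \<nu> m t))}"

text \<open>Used only for \<open>1 \<le> m < l < n\<close>, where both exponents are positive.\<close>

definition T3_set :: "nat \<Rightarrow> nat \<Rightarrow> nat \<Rightarrow> ((real \<Rightarrow> real) \<times> (real \<Rightarrow> real)) set" where
  "T3_set n m l = {(M, N). (M, N) \<in> Luchko n \<and>
     (\<exists>M\<^sub>m N\<^sub>m. (M\<^sub>m, N\<^sub>m) \<in> T_set m \<and>
        (\<forall>t>0. M t = conv (one_pow (n - l)) M\<^sub>m t \<and> N t = conv (one_pow (l - m)) N\<^sub>m t))}"

definition gf_integral :: "(real \<Rightarrow> real) \<Rightarrow> (real \<Rightarrow> real) \<Rightarrow> real \<Rightarrow> real" where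
  "gf_integral K X = conv K X"

definition gf_deriv_Caputo ::
  "nat \<Rightarrow> (real \<Rightarrow> real) \<Rightarrow> (real \<Rightarrow> real) \<Rightarrow> real \<Rightarrow> real" where
  "gf_deriv_Caputo n N X = conv N ((deriv ^^ n) X)"

definition C_m1_kernel :: "(real \<Rightarrow> real) \<Rightarrow> (real \<Rightarrow> real) set" where
  "C_m1_kernel N = {X. \<exists>Y\<in>C_m1. \<forall>t>0. X t = gf_integral N Y t}"

end

theory Submission
  imports Defs
begin

text \<open>
  Write \<open>*\<close> for convolution. Let \<open>X = N * Y\<close> with \<open>Y \<in> C_m1\<close>. The relation \<open>M * N = {1}\<^sup>n\<close> of a Luchko
  pair and associativity give \<open>M * X = M * (N * Y) = (M * N) * Y = {1}\<^sup>n * Y\<close>, which is the \<open>n\<close>-fold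
  repeated integral of \<open>Y\<close> from \<open>0\<close>. Its \<open>n\<close>-th derivative is \<open>Y\<close>, because functions in \<open>C_m1\<close> are
  continuous on the open half-line, so the Caputo-type derivative of \<open>M * X\<close> is \<open>N * Y = X\<close>.

  The analytic content is therefore that convolution is a commutative and associative product on
  \<open>C_m1\<close> (\<open>conv_in_C_m1\<close>, \<open>conv_commute\<close>, \<open>conv_assoc\<close>), and that convolution with \<open>{1}\<^sup>n\<close> is inverted by
  \<open>n\<close> differentiations (\<open>conv_one_pow_inverse\<close>).

  Closure is the central estimate. If \<open>f t = t\<^sup>p G t\<close> and \<open>g t = t\<^sup>q H t\<close>, the substitution \<open>\<tau> = t u\<close> turns
  \<open>(f * g) t\<close> into \<open>t\<close> to the power \<open>p + q + 1\<close> times the integral over \<open>0 < u < 1\<close> of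
  \<open>(1 - u)\<^sup>p u\<^sup>q G (t (1 - u)) H (t u)\<close>. The weight is that of Euler's Beta integral, which
  converges since \<open>p, q > -1\<close>. Dominated convergence makes the integral continuous in \<open>t\<close> down to
  \<open>t = 0\<close>, and \<open>p + q + 1 > -1\<close>, so \<open>f * g\<close> lies in \<open>C_m1\<close> again. The same estimate, applied to
  \<open>\<bar>f\<bar>\<close>, \<open>\<bar>g\<bar>\<close> and \<open>\<bar>h\<bar>\<close>, supplies the absolute integrability that Fubini's theorem requires for
  associativity.
\<close>

section \<open>Convolution as an integral over the line\<close>

text \<open>
  Extending by zero removes the dependence of the domain of integration on \<open>t\<close>: it makes \<open>conv\<close>
  the ordinary convolution on the whole line, for which affine changes of variable and Fubini's
  theorem on \<open>lborel\<close> need no bookkeeping of limits.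
\<close>

definition zero_ext :: "(real \<Rightarrow> real) \<Rightarrow> real \<Rightarrow> real" where
  "zero_ext f x = indicator {0<..} x * f x"

lemma zero_ext_simps [simp]: "x > 0 \<Longrightarrow> zero_ext f x = f x" "x \<le> 0 \<Longrightarrow> zero_ext f x = 0"
  by (auto simp: zero_ext_def)

lemma conv_eq_zero_ext: "conv f g t = (\<integral>\<tau>. zero_ext f (t - \<tau>) * zero_ext g \<tau> \<partial>lborel)"
  unfolding conv_def set_lebesgue_integral_def
  by (rule Bochner_Integration.integral_cong) (auto simp: zero_ext_def indicator_def)

lemma conv_nonpos [simp]: "t \<le> 0 \<Longrightarrow> conv f g t = 0"
  by (simp add: conv_def set_lebesgue_integral_def)

lemma zero_ext_conv [simp]: "zero_ext (conv f g) = conv f g"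
  by (rule ext) (metis conv_nonpos linorder_not_less zero_ext_simps)

lemma conv_cong:
  assumes "\<And>t. t > 0 \<Longrightarrow> f t = f' t" "\<And>t. t > 0 \<Longrightarrow> g t = g' t"
  shows "conv f g = conv f' g'"
proof -
  have "zero_ext f = zero_ext f'" "zero_ext g = zero_ext g'"
    using assms by (auto simp: zero_ext_def indicator_def)
  then show ?thesis by (intro ext) (simp only: conv_eq_zero_ext)
qed

lemma conv_commute: "conv f g = conv g f"
proof
  fix t
  show "conv f g t = conv g f t"
    using lborel_integral_real_affine[of "-1" "\<lambda>\<tau>. zero_ext f (t - \<tau>) * zero_ext g \<tau>" t]
    by (simp add: conv_eq_zero_ext mult.commute)
qed

section \<open>Functions with an integrable power singularity at the origin\<close>

text \<open>The continuous factor is only given on the closed half-line. Extending it constantly to the left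
  makes it continuous, and hence Borel measurable, on the whole line.\<close>

lemma C_m1_continuous_rep:
  assumes "f \<in> C_m1"
  obtains p g where "p > -1" "continuous_on UNIV g" "\<And>t. t > 0 \<Longrightarrow> f t = t powr p * g t"
proof -
  from assms obtain p g where *: "p > -1" "continuous_on {0..} g" "\<And>t. t > 0 \<Longrightarrow> f t = t powr p * g t"
    by (auto simp: C_m1_def)
  have "continuous_on UNIV (\<lambda>t. g (max 0 t))"
    by (intro continuous_on_compose2[OF *(2)] continuous_intros) auto
  with * that[of p "\<lambda>t. g (max 0 t)"] show ?thesis by auto
qed

lemma C_m1_continuous_on:
  assumes "f \<in> C_m1"
  shows "continuous_on {0<..} f"
proof -
  obtain p g where *: "p > -1" "continuous_on UNIV g" "\<And>t. t > 0 \<Longrightarrow> f t = t powr p * g t"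
    using C_m1_continuous_rep[OF assms] by blast
  have "continuous_on {0<..} (\<lambda>t. t powr p * g t)"
    by (intro continuous_intros continuous_on_subset[OF *(2)]) auto
  then show ?thesis by (rule continuous_on_eq) (simp add: *)
qed

lemma C_m1_cong:
  assumes "f \<in> C_m1" "\<And>t. t > 0 \<Longrightarrow> g t = f t"
  shows "g \<in> C_m1"
  using assms unfolding C_m1_def by simp

lemma C_m1_abs:
  assumes "f \<in> C_m1"
  shows "(\<lambda>t. \<bar>f t\<bar>) \<in> C_m1"
proof -
  obtain p g where *: "p > -1" "continuous_on UNIV g" "\<And>t. t > 0 \<Longrightarrow> f t = t powr p * g t"
    using C_m1_continuous_rep[OF assms] by blast
  have "continuous_on {0..} (\<lambda>t. \<bar>g t\<bar>)"
    by (intro continuous_on_rabs continuous_on_subset[OF *(2)]) simp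
  moreover have "\<forall>t>0. \<bar>f t\<bar> = t powr p * \<bar>g t\<bar>"
    by (simp add: *(3) abs_mult)
  ultimately show ?thesis
    using *(1) unfolding C_m1_def by blast
qed

lemma measurable_zero_ext:
  assumes "f \<in> C_m1"
  shows "zero_ext f \<in> borel_measurable borel"
  using borel_measurable_continuous_on_indicator[OF _ C_m1_continuous_on[OF assms]]
  by (simp add: zero_ext_def[abs_def])

section \<open>The Beta integral and closure under convolution\<close>

definition beta_weight :: "real \<Rightarrow> real \<Rightarrow> real \<Rightarrow> real" where
  "beta_weight p q u = indicator {0<..<1} u * ((1 - u) powr p * u powr q)"

lemma beta_weight_nonneg: "beta_weight p q u \<ge> 0"
  by (simp add: beta_weight_def)

lemma measurable_beta_weight [measurable]: "beta_weight p q \<in> borel_measurable borel"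
  unfolding beta_weight_def by measurable

lemma integrable_beta_weight:
  assumes "p > -1" "q > -1"
  shows "integrable lborel (beta_weight p q)"
proof -
  have "(\<lambda>u. u powr q * (1 - u) powr p) absolutely_integrable_on {0..1::real}"
    using has_integral_Beta_real[of "q + 1" "p + 1"] assms
    by (intro nonnegative_absolutely_integrable_1) (auto simp: has_integral_integrable)
  then have "(\<lambda>u. u powr q * (1 - u) powr p) absolutely_integrable_on {0<..<1::real}"
    by (rule set_integrable_subset) auto
  then have "integrable lebesgue (beta_weight p q)"
    by (simp add: set_integrable_def beta_weight_def[abs_def] mult.commute)
  then show ?thesis by (subst (asm) integrable_completion) auto
qed

text \<open>
  For \<open>0 < u < 1\<close> both \<open>t * (1 - u)\<close> and \<open>t * u\<close> stay in the compact interval \<open>[0, b]\<close>, where the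
  continuous factors are bounded. The bound is uniform in \<open>t\<close>, as dominated convergence requires.
\<close>

lemma beta_integrand_bound:
  fixes G H :: "real \<Rightarrow> real"
  assumes "continuous_on UNIV G" "continuous_on UNIV H"
  obtains B where "\<And>t u. t \<in> {0..b} \<Longrightarrow>
    \<bar>beta_weight p q u * (G (t * (1 - u)) * H (t * u))\<bar> \<le> B * beta_weight p q u"
proof -
  have "bounded (G ` {0..b})" "bounded (H ` {0..b})"
    using assms
    by (intro compact_imp_bounded compact_continuous_image compact_Icc;
        blast intro: continuous_on_subset)+
  then obtain C D where C: "\<And>x. x \<in> {0..b} \<Longrightarrow> \<bar>G x\<bar> \<le> C" and D: "\<And>x. x \<in> {0..b} \<Longrightarrow> \<bar>H x\<bar> \<le> D"
    unfolding bounded_iff real_norm_def by blast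
  show ?thesis
  proof (rule that[of "C * D"])
    fix t u assume t: "t \<in> {0..b}"
    show "\<bar>beta_weight p q u * (G (t * (1 - u)) * H (t * u))\<bar> \<le> C * D * beta_weight p q u"
    proof (cases "u \<in> {0<..<1}")
      case True
      have "t * (1 - u) \<le> b" "t * u \<le> b"
        using t True mult_left_le[of "1 - u" t] mult_left_le[of u t] by auto
      then have "t * (1 - u) \<in> {0..b}" "t * u \<in> {0..b}"
        using t True by auto
      then have "\<bar>G (t * (1 - u)) * H (t * u)\<bar> \<le> C * D"
        unfolding abs_mult using C D abs_ge_zero order_trans by (intro mult_mono) blast+
      then have "beta_weight p q u * \<bar>G (t * (1 - u)) * H (t * u)\<bar> \<le> beta_weight p q u * (C * D)"
        using beta_weight_nonneg by (rule mult_left_mono)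
      then show ?thesis
        by (simp only: abs_mult[of "beta_weight p q u"] abs_of_nonneg[OF beta_weight_nonneg] mult.commute)
    qed (auto simp: beta_weight_def)
  qed
qed

lemma integrable_beta_integrand:
  fixes G H :: "real \<Rightarrow> real"
  assumes "continuous_on UNIV G" "continuous_on UNIV H" "p > -1" "q > -1" "t \<ge> 0"
  shows "integrable lborel (\<lambda>u. beta_weight p q u * (G (t * (1 - u)) * H (t * u)))"
proof -
  have [measurable]: "G \<in> borel_measurable borel" "H \<in> borel_measurable borel"
    using assms by (auto intro: borel_measurable_continuous_onI)
  obtain B where "\<And>s u. s \<in> {0..t} \<Longrightarrow>
    \<bar>beta_weight p q u * (G (s * (1 - u)) * H (s * u))\<bar> \<le> B * beta_weight p q u"
    using beta_integrand_bound[OF assms(1,2)] by blast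
  then have B: "\<bar>beta_weight p q u * (G (t * (1 - u)) * H (t * u))\<bar> \<le> B * beta_weight p q u" for u
    using assms(5) by simp
  show ?thesis
  proof (rule Bochner_Integration.integrable_bound)
    show "integrable lborel (\<lambda>u. B * beta_weight p q u)"
      using integrable_beta_weight[OF assms(3,4)] by simp
    show "AE u in lborel. norm (beta_weight p q u * (G (t * (1 - u)) * H (t * u)))
        \<le> norm (B * beta_weight p q u)"
      using order_trans[OF B abs_ge_self] by (intro AE_I2) (simp only: real_norm_def)
  qed measurable
qed

lemma continuous_on_beta_integral:
  fixes G H :: "real \<Rightarrow> real"
  assumes "continuous_on UNIV G" "continuous_on UNIV H" "p > -1" "q > -1"
  shows "continuous_on {0..} (\<lambda>t. \<integral>u. beta_weight p q u * (G (t * (1 - u)) * H (t * u)) \<partial>lborel)"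
  unfolding continuous_on_sequentially comp_def
proof (intro ballI allI impI, elim conjE)
  fix s :: "nat \<Rightarrow> real" and t
  assume s: "\<forall>n. s n \<in> {0..}" "s \<longlonglongrightarrow> t"
  have [measurable]: "G \<in> borel_measurable borel" "H \<in> borel_measurable borel"
    using assms by (auto intro: borel_measurable_continuous_onI)
  from s(2) obtain b where b: "\<And>n. \<bar>s n\<bar> \<le> b"
    by (metis Bseq_def convergentI convergent_imp_Bseq real_norm_def)
  obtain B where B: "\<And>x u. x \<in> {0..b} \<Longrightarrow>
    \<bar>beta_weight p q u * (G (x * (1 - u)) * H (x * u))\<bar> \<le> B * beta_weight p q u"
    using beta_integrand_bound[OF assms(1,2)] by blast
  show "(\<lambda>n. \<integral>u. beta_weight p q u * (G (s n * (1 - u)) * H (s n * u)) \<partial>lborel)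
    \<longlonglongrightarrow> (\<integral>u. beta_weight p q u * (G (t * (1 - u)) * H (t * u)) \<partial>lborel)"
  proof (rule integral_dominated_convergence[where w = "\<lambda>u. B * beta_weight p q u"])
    show "integrable lborel (\<lambda>u. B * beta_weight p q u)"
      using integrable_beta_weight[OF assms(3,4)] by simp
    have "isCont G x" "isCont H x" for x
      using assms(1,2) by (auto simp: continuous_on_eq_continuous_at)
    then show "AE u in lborel. (\<lambda>n. beta_weight p q u * (G (s n * (1 - u)) * H (s n * u)))
        \<longlonglongrightarrow> beta_weight p q u * (G (t * (1 - u)) * H (t * u))"
      by (intro AE_I2 tendsto_intros isCont_tendsto_compose[where g = G] isCont_tendsto_compose[where g = H] s)
    have "s n \<in> {0..b}" for n
      using s(1) b[of n] by auto
    then show "AE u in lborel. norm (beta_weight p q u * (G (s n * (1 - u)) * H (s n * u)))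
        \<le> B * beta_weight p q u" for n
      using B by auto
  qed measurable
qed

text \<open>
  The integrand of the convolution at \<open>\<tau> = t * u\<close>. For \<open>u\<close> outside \<open>(0, 1)\<close>
  one of the two arguments is not positive, so both sides vanish.
\<close>

lemma conv_integrand_scaled:
  assumes "\<And>t. t > 0 \<Longrightarrow> f t = t powr p * G t" "\<And>t. t > 0 \<Longrightarrow> g t = t powr q * H t" "t > 0"
  shows "zero_ext f (t - t * u) * zero_ext g (t * u) =
    t powr (p + q) * (beta_weight p q u * (G (t * (1 - u)) * H (t * u)))"
proof (cases "u \<in> {0<..<1}")
  case True
  then have pos: "t - t * u > 0" "t * u > 0" using assms(3) by auto
  have eq: "t - t * u = t * (1 - u)" by (simp add: algebra_simps)
  have "(t * (1 - u)) powr p = t powr p * (1 - u) powr p" "(t * u) powr q = t powr q * u powr q"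
    using True assms(3) by (simp_all add: powr_mult)
  with True pos show ?thesis
    by (simp add: assms(1,2) beta_weight_def powr_add eq)
next
  case False
  then have "t - t * u \<le> 0 \<or> t * u \<le> 0"
    using assms(3) by (auto simp: mult_le_0_iff not_less)
  with False show ?thesis by (auto simp: beta_weight_def)
qed

lemma integrable_conv:
  assumes "f \<in> C_m1" "g \<in> C_m1"
  shows "integrable lborel (\<lambda>\<tau>. zero_ext f (t - \<tau>) * zero_ext g \<tau>)"
proof (cases "t > 0")
  case True
  obtain p G where f: "p > -1" "continuous_on UNIV G" "\<And>t. t > 0 \<Longrightarrow> f t = t powr p * G t"
    using C_m1_continuous_rep[OF assms(1)] by blast
  obtain q H where g: "q > -1" "continuous_on UNIV H" "\<And>t. t > 0 \<Longrightarrow> g t = t powr q * H t"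
    using C_m1_continuous_rep[OF assms(2)] by blast
  have scaled: "zero_ext f (t - t * u) * zero_ext g (t * u) =
    t powr (p + q) * (beta_weight p q u * (G (t * (1 - u)) * H (t * u)))" for u
    by (rule conv_integrand_scaled[where G = G and H = H]) (simp_all add: f(3) g(3) True)
  have "integrable lborel (\<lambda>u. zero_ext f (t - t * u) * zero_ext g (t * u))"
    unfolding scaled
    using integrable_beta_integrand[OF f(2) g(2) f(1) g(1), of t] True by simp
  then show ?thesis
    using lborel_integrable_real_affine_iff[of t "\<lambda>\<tau>. zero_ext f (t - \<tau>) * zero_ext g \<tau>" 0] True by simp
next
  case False
  then have "(\<lambda>\<tau>. zero_ext f (t - \<tau>) * zero_ext g \<tau>) = (\<lambda>_. 0)"
    by (auto simp: zero_ext_def indicator_def)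
  then show ?thesis by simp
qed

lemma conv_in_C_m1:
  assumes "f \<in> C_m1" "g \<in> C_m1"
  shows "conv f g \<in> C_m1"
proof -
  obtain p G where f: "p > -1" "continuous_on UNIV G" "\<And>t. t > 0 \<Longrightarrow> f t = t powr p * G t"
    using C_m1_continuous_rep[OF assms(1)] by blast
  obtain q H where g: "q > -1" "continuous_on UNIV H" "\<And>t. t > 0 \<Longrightarrow> g t = t powr q * H t"
    using C_m1_continuous_rep[OF assms(2)] by blast
  let ?k = "\<lambda>t. \<integral>u. beta_weight p q u * (G (t * (1 - u)) * H (t * u)) \<partial>lborel"
  have "conv f g t = t powr (p + q + 1) * ?k t" if "t > 0" for t
  proof -
    have scaled: "zero_ext f (t - t * u) * zero_ext g (t * u) =
    t powr (p + q) * (beta_weight p q u * (G (t * (1 - u)) * H (t * u)))" for u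
      by (rule conv_integrand_scaled[where G = G and H = H]) (simp_all add: f(3) g(3) that)
    have "conv f g t = t * (\<integral>u. zero_ext f (t - t * u) * zero_ext g (t * u) \<partial>lborel)"
      unfolding conv_eq_zero_ext
      using lborel_integral_real_affine[of t "\<lambda>\<tau>. zero_ext f (t - \<tau>) * zero_ext g \<tau>" 0] that by simp
    also have "\<dots> = t * (t powr (p + q) * ?k t)"
      unfolding scaled by simp
    finally show ?thesis using that by (simp add: powr_add)
  qed
  moreover have "continuous_on {0..} ?k"
    by (rule continuous_on_beta_integral[OF f(2) g(2) f(1) g(1)])
  \<comment> \<open>The Jacobian \<open>t\<close> of the substitution supplies the summand \<open>1\<close> of the exponent; without it
    \<open>p + q\<close> could drop to \<open>-1\<close> or below.\<close>
  moreover have "p + q + 1 > -1" using f(1) g(1) by simp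
  ultimately show ?thesis unfolding C_m1_def by blast
qed

section \<open>Associativity\<close>

text \<open>
  Both sides are iterated integrals of \<open>f (t - \<sigma>) g (\<sigma> - \<tau>) h \<tau>\<close>. Integrating its modulus first over
  \<open>\<sigma>\<close> gives \<open>(\<bar>f\<bar> * \<bar>g\<bar>) (t - \<tau>) \<bar>h \<tau>\<bar>\<close>, which is integrable in \<open>\<tau>\<close> because \<open>\<bar>f\<bar> * \<bar>g\<bar>\<close> is again
  in \<open>C_m1\<close>.
\<close>

lemma conv_assoc:
  assumes "f \<in> C_m1" "g \<in> C_m1" "h \<in> C_m1"
  shows "conv (conv f g) h = conv f (conv g h)"
proof
  fix t :: real
  note [measurable] = assms[THEN measurable_zero_ext]
  let ?F = "\<lambda>\<tau> \<sigma>. zero_ext f (t - \<sigma>) * zero_ext g (\<sigma> - \<tau>) * zero_ext h \<tau>"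
  have shift: "(\<integral>\<sigma>. zero_ext a (t - \<sigma>) * zero_ext b (\<sigma> - \<tau>) \<partial>lborel) = conv a b (t - \<tau>)" for a b \<tau>
    using lborel_integral_real_affine[of 1 "\<lambda>\<sigma>. zero_ext a (t - \<sigma>) * zero_ext b (\<sigma> - \<tau>)" \<tau>]
    by (simp add: conv_eq_zero_ext algebra_simps)
  have "integrable (lborel \<Otimes>\<^sub>M lborel) (case_prod ?F)"
  proof (rule lborel_pair.Fubini_integrable)
    show "integrable lborel (\<lambda>\<tau>. \<integral>\<sigma>. norm (case (\<tau>, \<sigma>) of (\<tau>, \<sigma>) \<Rightarrow> ?F \<tau> \<sigma>) \<partial>lborel)"
    proof -
      let ?f = "\<lambda>t. \<bar>f t\<bar>" and ?g = "\<lambda>t. \<bar>g t\<bar>" and ?h = "\<lambda>t. \<bar>h t\<bar>"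
      have abs: "\<bar>zero_ext k x\<bar> = zero_ext (\<lambda>t. \<bar>k t\<bar>) x" for k x
        by (simp add: zero_ext_def abs_mult)
      have "(\<lambda>\<tau>. \<integral>\<sigma>. norm (case (\<tau>, \<sigma>) of (\<tau>, \<sigma>) \<Rightarrow> ?F \<tau> \<sigma>) \<partial>lborel) =
          (\<lambda>\<tau>. zero_ext (conv ?f ?g) (t - \<tau>) * zero_ext ?h \<tau>)"
        by (simp add: abs_mult abs shift)
      moreover have "integrable lborel (\<lambda>\<tau>. zero_ext (conv ?f ?g) (t - \<tau>) * zero_ext ?h \<tau>)"
        by (intro integrable_conv conv_in_C_m1 C_m1_abs assms)
      ultimately show ?thesis by (simp only:)
    qed
    have "integrable lborel (\<lambda>\<sigma>. zero_ext f (t - \<sigma>) * zero_ext g (\<sigma> - \<tau>))" for \<tau>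
      using lborel_integrable_real_affine_iff[of 1 "\<lambda>\<sigma>. zero_ext f (t - \<sigma>) * zero_ext g (\<sigma> - \<tau>)" \<tau>]
        integrable_conv[OF assms(1,2), of "t - \<tau>"]
      by (simp add: algebra_simps)
    then show "AE \<tau> in lborel. integrable lborel (\<lambda>\<sigma>. case (\<tau>, \<sigma>) of (\<tau>, \<sigma>) \<Rightarrow> ?F \<tau> \<sigma>)"
      by simp
  qed measurable
  then have "(\<integral>\<sigma>. (\<integral>\<tau>. ?F \<tau> \<sigma> \<partial>lborel) \<partial>lborel) = (\<integral>\<tau>. (\<integral>\<sigma>. ?F \<tau> \<sigma> \<partial>lborel) \<partial>lborel)"
    by (rule lborel_pair.Fubini_integral)
  moreover have "(\<integral>\<tau>. (\<integral>\<sigma>. ?F \<tau> \<sigma> \<partial>lborel) \<partial>lborel) = conv (conv f g) h t"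
    by (simp add: shift conv_eq_zero_ext[of "conv f g"])
  moreover have "(\<integral>\<sigma>. (\<integral>\<tau>. ?F \<tau> \<sigma> \<partial>lborel) \<partial>lborel) = conv f (conv g h) t"
    by (simp add: mult.assoc conv_eq_zero_ext[of g, symmetric] conv_eq_zero_ext[of f "conv g h"])
  ultimately show "conv (conv f g) h t = conv f (conv g h) t" by simp
qed

section \<open>Differentiating repeated integrals\<close>

lemma one_in_C_m1: "(\<lambda>_. 1) \<in> C_m1"
  unfolding C_m1_def by (auto intro!: exI[of _ 0] exI[of _ "\<lambda>_. 1"])

lemma one_pow_Suc_Suc: "one_pow (Suc (Suc k)) = conv (one_pow (Suc k)) (\<lambda>_. 1)"
  by (simp add: one_pow_def)

lemma one_pow_Suc_in_C_m1: "one_pow (Suc k) \<in> C_m1"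
proof (induction k)
  case 0
  then show ?case using one_in_C_m1 by (simp add: one_pow_def)
next
  case (Suc k)
  then show ?case unfolding one_pow_Suc_Suc by (rule conv_in_C_m1[OF _ one_in_C_m1])
qed

text \<open>
  Convolution with \<open>1\<close> is integration from \<open>0\<close>. The integrand may be unbounded at \<open>0\<close>, so the
  version of the fundamental theorem used here asks for integrability on the whole interval and
  for continuity at the point \<open>t\<close> only.
\<close>

lemma has_derivative_conv_one:
  assumes "h \<in> C_m1" "t > 0"
  shows "(conv (\<lambda>_. 1) h has_real_derivative h t) (at t)"
proof -
  have int: "set_integrable lborel {0<..<b} h" for b
  proof -
    have "(\<lambda>\<tau>. zero_ext (\<lambda>_. 1) (b - \<tau>) * zero_ext h \<tau>) = (\<lambda>\<tau>. indicator {0<..<b} \<tau> *\<^sub>R h \<tau>)"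
      by (auto simp: zero_ext_def indicator_def)
    then show ?thesis
      using integrable_conv[OF one_in_C_m1 assms(1), of b] by (simp add: set_integrable_def)
  qed
  have conv: "conv (\<lambda>_. 1) h b = integral {0..b} h" for b
    using set_borel_integral_eq_integral[OF int[of b]]
    by (simp add: conv_def integral_open_interval_real)
  have "h integrable_on {0..t + 1}"
    using set_borel_integral_eq_integral[OF int[of "t + 1"]]
    by (simp add: integrable_on_open_interval_real)
  moreover have "continuous (at t within {0..t + 1} - {}) h"
    using C_m1_continuous_on[OF assms(1)] assms(2)
    by (simp add: continuous_on_eq_continuous_at continuous_at_imp_continuous_at_within)
  moreover have "t \<in> {0..t + 1} - {}" using assms(2) by simp
  ultimately have "((\<lambda>b. integral {0..b} h) has_vector_derivative h t) (at t within {0..t + 1} - {})"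
    by (intro integral_has_vector_derivative_continuous_at finite.emptyI)
  then show ?thesis
    using assms(2)
    by (simp add: conv[abs_def] at_within_Icc_at has_real_derivative_iff_has_vector_derivative)
qed

text \<open>
  The convolution power grows by a factor \<open>1\<close> on the right. To exhibit the convolution with \<open>Y\<close> as
  an integral, this factor has to be brought to the front.
\<close>

lemma conv_one_pow_Suc_Suc:
  assumes "Y \<in> C_m1"
  shows "conv (one_pow (Suc (Suc k))) Y = conv (\<lambda>_. 1) (conv (one_pow (Suc k)) Y)"
  unfolding one_pow_Suc_Suc conv_commute[of _ "\<lambda>_. 1"]
  by (rule conv_assoc[OF one_in_C_m1 one_pow_Suc_in_C_m1 assms])

text \<open>
  The hypothesis on \<open>F\<close> is limited to positive arguments so that the lemma can be iterated: an
  iterated \<open>deriv\<close> is known there only. The case \<open>j = 0\<close> is separate because \<open>one_pow 0\<close> is the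
  zero function and not a unit for convolution.
\<close>

lemma deriv_conv_one_pow:
  assumes "Y \<in> C_m1" "\<And>t. t > 0 \<Longrightarrow> F t = conv (one_pow (Suc j)) Y t" "t > 0"
  shows "F differentiable at t"
    and "deriv F t = (if j = 0 then Y t else conv (one_pow j) Y t)"
proof -
  let ?D = "if j = 0 then Y else conv (one_pow j) Y"
  have eq: "conv (one_pow (Suc j)) Y = conv (\<lambda>_. 1) ?D"
    using conv_one_pow_Suc_Suc[OF assms(1)] by (cases j) (auto simp: one_pow_def)
  have "?D \<in> C_m1"
    using assms(1) by (cases j) (auto intro: conv_in_C_m1[OF one_pow_Suc_in_C_m1])
  from has_derivative_conv_one[OF this assms(3)] eq
  have "(conv (one_pow (Suc j)) Y has_real_derivative ?D t) (at t)" by simp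
  then have "(F has_real_derivative ?D t) (at t)"
    by (rule has_field_derivative_transform_within_open[of _ _ _ "{0<..}"])
      (use assms in auto)
  then show "F differentiable at t" "deriv F t = (if j = 0 then Y t else conv (one_pow j) Y t)"
    by (auto simp: real_differentiable_def DERIV_imp_deriv split: if_splits)
qed

text \<open>
  The bound on \<open>k\<close> is strict: at \<open>k = n\<close> the derivative is \<open>Y\<close>, whereas convolution with
  \<open>one_pow 0\<close> would give zero.
\<close>

lemma higher_deriv_conv_one_pow:
  assumes "Y \<in> C_m1" "k < n" "\<And>t. t > 0 \<Longrightarrow> F t = conv (one_pow n) Y t"
  shows "\<And>t. t > 0 \<Longrightarrow> (deriv ^^ k) F t = conv (one_pow (n - k)) Y t"
  using assms(2)
proof (induction k)
  case 0
  then show ?case using assms(3) by simp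
next
  case (Suc k)
  have "(deriv ^^ k) F t = conv (one_pow (Suc (n - Suc k))) Y t" if "t > 0" for t
    using Suc that by (simp add: Suc_diff_Suc)
  from deriv_conv_one_pow(2)[OF assms(1) this Suc.prems(1)] Suc.prems(2) show ?case
    by simp
qed

lemma conv_one_pow_inverse:
  assumes "Y \<in> C_m1" "n \<ge> 1" "\<And>t. t > 0 \<Longrightarrow> F t = conv (one_pow n) Y t"
  shows "F \<in> C_m1_diff n" and "\<And>t. t > 0 \<Longrightarrow> (deriv ^^ n) F t = Y t"
proof -
  have lower: "(deriv ^^ k) F t = conv (one_pow (Suc (n - Suc k))) Y t" if "k < n" "t > 0" for k t
    using higher_deriv_conv_one_pow[OF assms(1) that(1) assms(3) that(2)] that(1)
    by (simp add: Suc_diff_Suc)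
  show top: "(deriv ^^ n) F t = Y t" if "t > 0" for t
    using deriv_conv_one_pow(2)[OF assms(1) lower that, of "n - 1"] assms(2)
    by (cases n) auto
  show "F \<in> C_m1_diff n"
    unfolding C_m1_diff_def
    using deriv_conv_one_pow(1)[OF assms(1) lower] C_m1_cong[OF assms(1) top] by blast
qed

theorem theorem6:
  fixes n m l :: nat and M N X :: "real \<Rightarrow> real"
  assumes "1 \<le> m" "m \<le> n - 1" "m + 1 \<le> l" "l \<le> n - 1"
    and "(M, N) \<in> T3_set n m l"
    and "X \<in> C_m1_kernel N"
  shows "X \<in> C_m1 \<and> gf_integral M X \<in> C_m1_diff n \<and>
         (\<forall>t>0. gf_deriv_Caputo n N (gf_integral M X) t = X t)"
proof -
  have MN: "M \<in> C_m1" "N \<in> C_m1" "\<And>t. t > 0 \<Longrightarrow> conv M N t = one_pow n t"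
    using assms(5) by (auto simp: T3_set_def Luchko_def)
  obtain Y where Y: "Y \<in> C_m1" and X: "\<And>t. t > 0 \<Longrightarrow> X t = conv N Y t"
    using assms(6) by (auto simp: C_m1_kernel_def gf_integral_def)
  have "conv M X = conv M (conv N Y)"
    by (rule conv_cong) (simp_all add: X)
  also have "\<dots> = conv (conv M N) Y"
    by (rule conv_assoc[OF MN(1,2) Y, symmetric])
  also have "\<dots> = conv (one_pow n) Y"
    by (rule conv_cong) (simp_all add: MN(3))
  finally have F: "gf_integral M X t = conv (one_pow n) Y t" for t
    by (simp add: gf_integral_def)
  have n: "n \<ge> 1" using assms by simp
  note inv = conv_one_pow_inverse[OF Y n F]
  have "gf_deriv_Caputo n N (gf_integral M X) = conv N Y"
    unfolding gf_deriv_Caputo_def by (rule conv_cong) (simp_all add: inv(2))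
  then show ?thesis
    using C_m1_cong[OF conv_in_C_m1[OF MN(2) Y] X] inv(1) X by simp
qed

end
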